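(* Let $A$ be any finite set of positive rational numbers. Then $$\rho(A)=\underline{\rho}(A)=\rho_{\log}(A)=\underline{\rho}_{\log}(A)=\overline{\rho}_{\log}(A).$$ Moreover, there exists an $A$-quotient-free set $S$ such that the asymptotic density $\delta(S)$ exists and $\delta(S)=\rho(A)$.
   Context: A set $S$ of positive integers is called $A$-quotient-free if there are no $x,y\in S$ with $x/y\in A$. For $X>0$ let $[X]=\{k\in\mathbb{N}: k\le X\}$. For $S\subseteq\mathbb{N}$: upper/lower asymptotic density $\overline{\delta}(S)=\limsup_{X\to\infty}|S\cap[X]|/X$, $\underline{\delta}(S)=\liminf_{X\to\infty}|S\cap[X]|/X$; if they are equal, their common value is the asymptotic density $\delta(S)$. Upper/lower logarithmic density: $\overline{\delta}_{\log}(S)=\limsup_{X\to\infty}\frac{\sum_{k\in S,k\le X}1/k}{\ln X}$, $\underline{\delta}_{\log}(S)=\liminf_{X\to\infty}\frac{\sum_{k\in S,k\le X}1/k}{\ln X}$; if equal, the common value is $\delta_{\log}(S)$. Define $\underline{\rho}(A)=\sup_S\underline{\delta}(S)$, $\underline{\rho}_{\log}(A)=\sup_S\underline{\delta}_{\log}(S)$, $\overline{\rho}_{\log}(A)=\sup_S\overline{\delta}_{\log}(S)$, with suprema over all $A$-quotient-free sets $S$; $\rho(A)=\sup_S\delta(S)$ over all $A$-quotient-free $S$ for which $\delta(S)$ exists; $\rho_{\log}(A)=\sup_S\delta_{\log}(S)$ over all $A$-quotient-free $S$ for which $\delta_{\log}(S)$ exists. *)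

theory Defs
  imports Complex_Main "HOL-Library.Extended_Real" "HOL-Library.Liminf_Limsup"
begin

definition quotient_free :: "rat set \<Rightarrow> nat set \<Rightarrow> bool" where
  "quotient_free A S \<longleftrightarrow>
     (\<forall>x\<in>S. 0 < x) \<and> (\<forall>x\<in>S. \<forall>y\<in>S. (of_nat x / of_nat y :: rat) \<notin> A)"

definition initial_segment :: "real \<Rightarrow> nat set" where
  "initial_segment X = {k. 0 < k \<and> real k \<le> X}"

text \<open>Densities take values in the extended reals, where \<^const>\<open>Limsup\<close>, \<^const>\<open>Liminf\<close>
  and \<^const>\<open>Sup\<close> are total. The limits are over real \<open>X\<close> tending to infinity.\<close>

definition upper_density :: "nat set \<Rightarrow> ereal" where
  "upper_density S =
     Limsup at_top (\<lambda>X::real. ereal (real (card (S \<inter> initial_segment X)) / X))"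

definition lower_density :: "nat set \<Rightarrow> ereal" where
  "lower_density S =
     Liminf at_top (\<lambda>X::real. ereal (real (card (S \<inter> initial_segment X)) / X))"

definition upper_log_density :: "nat set \<Rightarrow> ereal" where
  "upper_log_density S =
     Limsup at_top (\<lambda>X::real. ereal ((\<Sum>k\<in>S \<inter> initial_segment X. 1 / real k) / ln X))"

definition lower_log_density :: "nat set \<Rightarrow> ereal" where
  "lower_log_density S =
     Liminf at_top (\<lambda>X::real. ereal ((\<Sum>k\<in>S \<inter> initial_segment X. 1 / real k) / ln X))"

definition has_density :: "nat set \<Rightarrow> ereal \<Rightarrow> bool" where
  "has_density S d \<longleftrightarrow> lower_density S = d \<and> upper_density S = d"

definition has_log_density :: "nat set \<Rightarrow> ereal \<Rightarrow> bool" where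
  "has_log_density S d \<longleftrightarrow> lower_log_density S = d \<and> upper_log_density S = d"

definition rho :: "rat set \<Rightarrow> ereal" where
  "rho A = Sup {d. \<exists>S. quotient_free A S \<and> has_density S d}"

definition rho_lower :: "rat set \<Rightarrow> ereal" where
  "rho_lower A = (SUP S\<in>{S. quotient_free A S}. lower_density S)"

definition rho_log :: "rat set \<Rightarrow> ereal" where
  "rho_log A = Sup {d. \<exists>S. quotient_free A S \<and> has_log_density S d}"

definition rho_log_lower :: "rat set \<Rightarrow> ereal" where
  "rho_log_lower A = (SUP S\<in>{S. quotient_free A S}. lower_log_density S)"

definition rho_log_upper :: "rat set \<Rightarrow> ereal" where
  "rho_log_upper A = (SUP S\<in>{S. quotient_free A S}. upper_log_density S)"

end

theory Submission
  imports Defs "HOL-Analysis.Analysis" "HOL-Computational_Algebra.Primes" "HOL-Real_Asymp.Real_Asymp"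
begin

text \<open>
  Let \<open>Q\<close> be a multiple of all numerators and denominators of elements of \<open>A\<close>. Every positive
  integer is uniquely \<open>m q\<close> with \<open>m\<close> composed of primes dividing \<open>Q\<close> and \<open>q\<close> coprime to \<open>Q\<close>, and
  a set \<open>S\<close> is \<open>A\<close>-quotient-free iff each slice \<open>{m. m q \<in> S}\<close> is. The reciprocals of the smooth
  numbers have a finite sum, so by compactness of the product space of subsets some quotient-free
  set \<open>T\<close> of smooth numbers maximises the sum \<open>W\<close> of reciprocals. Let \<open>\<theta>\<close> be the density of the
  integers coprime to \<open>Q\<close>. Summing reciprocals slice by slice bounds every upper logarithmic
  density by \<open>\<theta> W\<close>, while \<open>{m q | m \<in> T, q coprime to Q}\<close> has natural density exactly \<open>\<theta> W\<close>. As the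
  lower density never exceeds the lower logarithmic density, all five suprema equal \<open>\<theta> W\<close>.
\<close>

section \<open>Counting functions and densities\<close>

definition count_upto :: "nat set \<Rightarrow> nat \<Rightarrow> nat" where
  "count_upto S n = card (S \<inter> {0<..n})"

definition recip_sum :: "nat set \<Rightarrow> nat \<Rightarrow> real" where
  "recip_sum S n = (\<Sum>k\<in>S \<inter> {0<..n}. 1 / real k)"

text \<open>For negative \<open>X\<close> both sides are empty, as \<open>nat\<close> sends negative
  integers to 0. All densities over real \<open>X\<close> thereby reduce to counts at
  integers.\<close>

lemma initial_segment_eq: "initial_segment X = {0<..nat \<lfloor>X\<rfloor>}"
proof (intro Set.set_eqI iffI)
  fix k
  show "k \<in> {0<..nat \<lfloor>X\<rfloor>}" if "k \<in> initial_segment X"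
    using that by (simp add: initial_segment_def le_nat_floor)
  show "k \<in> initial_segment X" if "k \<in> {0<..nat \<lfloor>X\<rfloor>}"
  proof -
    have "0 < k" "k \<le> nat \<lfloor>X\<rfloor>" using that by auto
    then have "real k \<le> X" by linarith
    with \<open>0 < k\<close> show ?thesis by (simp add: initial_segment_def)
  qed
qed

section \<open>Partial summation\<close>

lemma count_upto_Suc:
  "count_upto S (Suc n) = count_upto S n + (if Suc n \<in> S then 1 else 0)"
proof -
  have "{0<..Suc n} = insert (Suc n) {0<..n}" by auto
  then show ?thesis by (auto simp: count_upto_def Int_insert_right)
qed

lemma recip_sum_Suc:
  "recip_sum S (Suc n) = recip_sum S n + (if Suc n \<in> S then 1 / real (Suc n) else 0)"
proof -
  have "{0<..Suc n} = insert (Suc n) {0<..n}" by auto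
  then show ?thesis by (auto simp: recip_sum_def Int_insert_right)
qed

lemma count_upto_le: "count_upto S n \<le> n"
  unfolding count_upto_def by (metis card_greaterThanAtMost card_mono diff_zero finite_greaterThanAtMost inf_le2)

lemma recip_sum_nonneg: "0 \<le> recip_sum S n"
  unfolding recip_sum_def by (intro sum_nonneg) auto

text \<open>Abel summation with \<open>1/k - 1/(k+1) = 1/(k(k+1))\<close>. The coefficients of the
  counts are nonnegative, so bounds on counts can be inserted term by term.\<close>

lemma recip_sum_by_parts:
  "recip_sum S n = real (count_upto S n) / real (n + 1)
     + (\<Sum>k\<in>{0<..n}. real (count_upto S k) / (real k * real (k + 1)))"
proof (induction n)
  case 0
  then show ?case by (simp add: recip_sum_def count_upto_def)
next
  case (Suc n)
  have "{0<..Suc n} = insert (Suc n) {0<..n}" by auto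
  then have *: "(\<Sum>k\<in>{0<..Suc n}. real (count_upto S k) / (real k * real (k + 1)))
     = (\<Sum>k\<in>{0<..n}. real (count_upto S k) / (real k * real (k + 1)))
       + real (count_upto S (Suc n)) / (real (Suc n) * real (Suc n + 1))"
    by simp
  \<comment> \<open>Here \<open>c\<close> is the old count and \<open>e\<close> the indicator of the
    new element; the identity behind it is
    \<open>1/(n+1) = 1/(n+2) + 1/((n+1)(n+2))\<close>.\<close>
  have **: "c / real (n+1) + e / real (n+1)
     = (c + e) / real (Suc n + 1) + (c + e) / (real (Suc n) * real (Suc n + 1))" for c e :: real
    by (simp add: divide_simps) (simp add: algebra_simps)
  show ?case
    unfolding * recip_sum_Suc Suc.IH count_upto_Suc using **[of "count_upto S n" "if Suc n \<in> S then 1 else 0"]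
    by (auto simp: ac_simps split: if_splits)
qed

text \<open>The right-hand side is that of \<open>recip_sum_by_parts\<close> with the counting function replaced by
  a linear one, so linear bounds on the counting function transfer to the sum of reciprocals.\<close>

lemma linear_by_parts:
  "d * harm n + B = (d * real n + B) / real (n + 1)
     + (\<Sum>k\<in>{0<..n}. (d * real k + B) / (real k * real (k + 1)))"
proof (induction n)
  case 0
  then show ?case by (simp add: harm_def)
next
  case (Suc n)
  have "{0<..Suc n} = insert (Suc n) {0<..n}" by auto
  then have *: "(\<Sum>k\<in>{0<..Suc n}. (d * real k + B) / (real k * real (k + 1)))
     = (\<Sum>k\<in>{0<..n}. (d * real k + B) / (real k * real (k + 1)))
       + (d * real (Suc n) + B) / (real (Suc n) * real (Suc n + 1))"
    by simp
  have **: "(d * real n + B) / real (n+1) + d * inverse (real (Suc n))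
     = (d * real (Suc n) + B) / real (Suc n + 1)
       + (d * real (Suc n) + B) / (real (Suc n) * real (Suc n + 1))"
    by (simp add: divide_simps) (simp add: algebra_simps)
  show ?case
    unfolding * harm_Suc using Suc.IH ** by (simp add: algebra_simps)
qed

lemma recip_sum_upper:
  assumes "\<And>k. real (count_upto S k) \<le> d * real k + B"
  shows "recip_sum S n \<le> d * harm n + B"
  unfolding recip_sum_by_parts linear_by_parts
  by (intro add_mono sum_mono divide_right_mono assms) auto

lemma recip_sum_lower:
  assumes "\<And>k. d * real k + B \<le> real (count_upto S k)"
  shows "d * harm n + B \<le> recip_sum S n"
  unfolding recip_sum_by_parts linear_by_parts
  by (intro add_mono sum_mono divide_right_mono assms) auto

section \<open>From bounds on counting functions to densities\<close>

text \<open>The differences \<open>harm n - ln n\<close> decrease from the value 1 at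
  \<open>n = 1\<close>.\<close>

lemma harm_le_ln:
  assumes "n > 0"
  shows "harm n \<le> 1 + ln (real n)"
proof -
  obtain m where "n = Suc m" using assms gr0_implies_Suc by blast
  then show ?thesis
    using decseq_harm_diff_ln[THEN decseqD, of 0 m] by (simp add: harm_def)
qed

lemma harm_floor_bounds:
  fixes X :: real
  assumes "X \<ge> 1"
  shows "ln X \<le> harm (nat \<lfloor>X\<rfloor>)" "harm (nat \<lfloor>X\<rfloor>) \<le> 1 + ln X"
proof -
  have "X \<le> real (nat \<lfloor>X\<rfloor>) + 1" using assms by linarith
  then have "ln X \<le> ln (real (nat \<lfloor>X\<rfloor>) + 1)" using assms by (intro ln_mono) linarith+
  \<comment> \<open>The bound \<open>ln_le_harm\<close> has \<open>ln (n + 1)\<close> on its left,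
    which absorbs the rounding down of \<open>X\<close>.\<close>
  then show "ln X \<le> harm (nat \<lfloor>X\<rfloor>)" using ln_le_harm[of "nat \<lfloor>X\<rfloor>"] by linarith
  have 1: "nat \<lfloor>X\<rfloor> > 0" "real (nat \<lfloor>X\<rfloor>) \<le> X" using assms by linarith+
  then have "ln (real (nat \<lfloor>X\<rfloor>)) \<le> ln X" using assms by (subst ln_le_cancel_iff) auto
  then show "harm (nat \<lfloor>X\<rfloor>) \<le> 1 + ln X" using harm_le_ln[OF 1(1)] by linarith
qed

lemma lower_density_eq:
  "lower_density S = Liminf at_top (\<lambda>X::real. ereal (real (count_upto S (nat \<lfloor>X\<rfloor>)) / X))"
  by (simp add: lower_density_def count_upto_def initial_segment_eq)

lemma upper_density_eq:
  "upper_density S = Limsup at_top (\<lambda>X::real. ereal (real (count_upto S (nat \<lfloor>X\<rfloor>)) / X))"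
  by (simp add: upper_density_def count_upto_def initial_segment_eq)

lemma lower_log_density_eq:
  "lower_log_density S = Liminf at_top (\<lambda>X::real. ereal (recip_sum S (nat \<lfloor>X\<rfloor>) / ln X))"
  by (simp add: lower_log_density_def recip_sum_def initial_segment_eq)

lemma upper_log_density_eq:
  "upper_log_density S = Limsup at_top (\<lambda>X::real. ereal (recip_sum S (nat \<lfloor>X\<rfloor>) / ln X))"
  by (simp add: upper_log_density_def recip_sum_def initial_segment_eq)

lemma lower_log_le_upper_log: "lower_log_density S \<le> upper_log_density S"
  unfolding lower_log_density_eq upper_log_density_eq by (intro Liminf_le_Limsup) simp

text \<open>Passes from integers to real \<open>X\<close>: the quotient at \<open>X\<close> is the
  quotient at the floor of \<open>X\<close> times a factor that tends to 1.\<close>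

lemma has_densityI:
  assumes "(\<lambda>n. real (count_upto S n) / real n) \<longlonglongrightarrow> c"
  shows "has_density S (ereal c)"
proof -
  have fl: "filterlim (\<lambda>X::real. nat \<lfloor>X\<rfloor>) sequentially at_top"
    by (rule filterlim_compose[OF filterlim_nat_sequentially filterlim_floor_sequentially])
  have "((\<lambda>X::real. (real (count_upto S (nat \<lfloor>X\<rfloor>)) / real (nat \<lfloor>X\<rfloor>)) * (real (nat \<lfloor>X\<rfloor>) / X))
      \<longlongrightarrow> c * 1) at_top"
  proof (intro tendsto_mult filterlim_compose[OF assms fl])
    have "((\<lambda>X::real. real_of_int \<lfloor>X\<rfloor> / X) \<longlongrightarrow> 1) at_top" by real_asymp
    moreover have "\<forall>\<^sub>F X::real in at_top. real_of_int \<lfloor>X\<rfloor> / X = real (nat \<lfloor>X\<rfloor>) / X"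
      using eventually_ge_at_top[of 1] by eventually_elim (simp add: floor_le_iff)
    ultimately show "((\<lambda>X::real. real (nat \<lfloor>X\<rfloor>) / X) \<longlongrightarrow> 1) at_top"
      by (rule Lim_transform_eventually)
  qed
  moreover have "\<forall>\<^sub>F X::real in at_top.
      (real (count_upto S (nat \<lfloor>X\<rfloor>)) / real (nat \<lfloor>X\<rfloor>)) * (real (nat \<lfloor>X\<rfloor>) / X)
       = real (count_upto S (nat \<lfloor>X\<rfloor>)) / X"
    using eventually_ge_at_top[of 1]
  proof eventually_elim
    case (elim X)
    then have "nat \<lfloor>X\<rfloor> > 0" by linarith
    then have "real (nat \<lfloor>X\<rfloor>) \<noteq> 0" by linarith
    then show ?case by (metis times_divide_times_eq mult.commute nonzero_mult_divide_mult_cancel_left)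
  qed
  ultimately have "((\<lambda>X::real. real (count_upto S (nat \<lfloor>X\<rfloor>)) / X) \<longlongrightarrow> c) at_top"
    using Lim_transform_eventually by force
  then have "((\<lambda>X::real. ereal (real (count_upto S (nat \<lfloor>X\<rfloor>)) / X)) \<longlongrightarrow> ereal c) at_top" by simp
  then show ?thesis
    unfolding has_density_def lower_density_eq upper_density_eq
    by (auto intro: lim_imp_Liminf lim_imp_Limsup)
qed

lemma upper_log_density_le:
  assumes "d \<ge> 0" "\<And>n. recip_sum S n \<le> d * harm n + B"
  shows "upper_log_density S \<le> ereal d"
proof -
  \<comment> \<open>The majorant is \<open>d * (1 + ln X) + B\<close> divided by
    \<open>ln X\<close>; the extra \<open>d\<close> is the 1 in the upper bound for
    \<open>harm\<close>.\<close>
  have "((\<lambda>X::real. d + (d + B) / ln X) \<longlongrightarrow> d + 0) at_top"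
    by (intro tendsto_intros real_tendsto_divide_at_top[OF tendsto_const ln_at_top])
  then have lim: "((\<lambda>X::real. ereal (d + (d + B) / ln X)) \<longlongrightarrow> ereal d) at_top" by simp
  have "upper_log_density S \<le> Limsup at_top (\<lambda>X::real. ereal (d + (d + B) / ln X))"
    unfolding upper_log_density_eq
  proof (rule Limsup_mono)
    show "\<forall>\<^sub>F X::real in at_top. ereal (recip_sum S (nat \<lfloor>X\<rfloor>) / ln X) \<le> ereal (d + (d + B) / ln X)"
      using eventually_ge_at_top[of 2]
    proof eventually_elim
      case (elim X)
      have "recip_sum S (nat \<lfloor>X\<rfloor>) \<le> d * harm (nat \<lfloor>X\<rfloor>) + B" by (rule assms)
      also have "\<dots> \<le> d * (1 + ln X) + B"
        using harm_floor_bounds(2)[of X] elim assms(1) by (intro add_mono mult_left_mono) auto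
      finally show ?case using elim by (simp add: divide_simps) (simp add: algebra_simps)
    qed
  qed
  also have "\<dots> = ereal d" using lim by (intro lim_imp_Limsup) auto
  finally show ?thesis .
qed

lemma lower_log_density_ge:
  assumes "d \<ge> 0" "\<And>n. d * harm n + B \<le> recip_sum S n"
  shows "ereal d \<le> lower_log_density S"
proof -
  have "((\<lambda>X::real. d + B / ln X) \<longlongrightarrow> d + 0) at_top"
    by (intro tendsto_intros real_tendsto_divide_at_top[OF tendsto_const ln_at_top])
  then have lim: "((\<lambda>X::real. ereal (d + B / ln X)) \<longlongrightarrow> ereal d) at_top" by simp
  then have "ereal d = Liminf at_top (\<lambda>X::real. ereal (d + B / ln X))"
    by (intro lim_imp_Liminf[symmetric]) auto
  also have "\<dots> \<le> lower_log_density S"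
    unfolding lower_log_density_eq
  proof (rule Liminf_mono)
    show "\<forall>\<^sub>F X::real in at_top. ereal (d + B / ln X) \<le> ereal (recip_sum S (nat \<lfloor>X\<rfloor>) / ln X)"
      using eventually_ge_at_top[of 2]
    proof eventually_elim
      case (elim X)
      have "d * ln X + B \<le> d * harm (nat \<lfloor>X\<rfloor>) + B"
        using harm_floor_bounds(1)[of X] elim assms(1) by (intro add_mono mult_left_mono) auto
      also have "\<dots> \<le> recip_sum S (nat \<lfloor>X\<rfloor>)" by (rule assms)
      finally show ?case using elim by (simp add: divide_simps)
    qed
  qed
  finally show ?thesis .
qed

text \<open>Any real \<open>d\<close> below the lower density gives a linear lower bound of slope
  \<open>d\<close> for the counts, hence by partial summation \<open>d\<close> is at most the lower
  logarithmic density.\<close>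

lemma lower_density_le_lower_log: "lower_density S \<le> lower_log_density S"
proof (rule ccontr)
  assume "\<not> ?thesis"
  then obtain d where d: "lower_log_density S < ereal d" "ereal d < lower_density S"
    by (metis ereal_dense2 not_le)
  \<comment> \<open>This forces \<open>d\<close> to be nonnegative, as multiplying inequalities by
    \<open>d\<close> requires.\<close>
  have "0 \<le> lower_log_density S"
    using lower_log_density_ge[of 0 0 S] recip_sum_nonneg[of S] by (simp add: zero_ereal_def)
  then have d0: "d \<ge> 0" using d(1) by (metis ereal_less_eq(5) less_le_not_le order.trans)
  have "\<forall>\<^sub>F X::real in at_top. ereal d < ereal (real (count_upto S (nat \<lfloor>X\<rfloor>)) / X)"
    using d(2) unfolding lower_density_eq by (rule less_LiminfD)
  then obtain X0 where X0: "\<And>X. X \<ge> X0 \<Longrightarrow> d < real (count_upto S (nat \<lfloor>X\<rfloor>)) / X"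
    by (auto simp: eventually_at_top_linorder)
  \<comment> \<open>The shift makes the left side nonpositive for small \<open>k\<close>, so the
    bound holds for every \<open>k\<close>. The added 1 ensures \<open>k > 0\<close> in the other
    case.\<close>
  have "d * real k + - (d * (\<bar>X0\<bar> + 1)) \<le> real (count_upto S k)" for k
  proof (cases "real k \<ge> \<bar>X0\<bar> + 1")
    case True
    then have "real k \<ge> X0" "real k > 0" by linarith+
    then have "d * real k < real (count_upto S k)"
      using X0[of "real k"] by (simp add: field_simps)
    moreover have "d * (\<bar>X0\<bar> + 1) \<ge> 0" using d0 by simp
    ultimately show ?thesis by linarith
  next
    case False
    then have "d * real k \<le> d * (\<bar>X0\<bar> + 1)" using d0 by (intro mult_left_mono) auto
    then show ?thesis by linarith
  qed
  then have "ereal d \<le> lower_log_density S"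
    using recip_sum_lower lower_log_density_ge d0 by metis
  then show False using d(1) by simp
qed

section \<open>Smooth and coprime parts\<close>

definition smooth :: "nat \<Rightarrow> nat set" where
  "smooth Q = {m. 0 < m \<and> (\<forall>p. prime p \<longrightarrow> p dvd m \<longrightarrow> p dvd Q)}"

definition coprimes :: "nat \<Rightarrow> nat set" where
  "coprimes Q = {q. 0 < q \<and> coprime q Q}"

lemma smooth_mult: "m \<in> smooth Q \<Longrightarrow> n \<in> smooth Q \<Longrightarrow> m * n \<in> smooth Q"
  by (auto simp: smooth_def prime_dvd_mult_iff)

lemma dvd_smooth: "m dvd Q \<Longrightarrow> 0 < m \<Longrightarrow> m \<in> smooth Q"
  by (auto simp: smooth_def intro: dvd_trans)

lemma coprime_smooth: "m \<in> smooth Q \<Longrightarrow> q \<in> coprimes Q \<Longrightarrow> coprime q m"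
proof (rule ccontr)
  assume mq: "m \<in> smooth Q" "q \<in> coprimes Q" "\<not> coprime q m"
  then obtain p where p: "prime p" "p dvd q" "p dvd m"
    by (metis coprime_iff_gcd_eq_1 gcd_nat.bounded_iff prime_factor_nat)
  with mq have "p dvd Q" "coprime q Q" by (auto simp: smooth_def coprimes_def)
  with p show False
    using coprime_common_divisor not_prime_unit by blast
qed

text \<open>As \<open>q\<close> is coprime to \<open>m'\<close>, it divides \<open>q'\<close>; by
  symmetry \<open>q'\<close> divides \<open>q\<close>.\<close>

lemma smooth_coprime_unique:
  assumes "m \<in> smooth Q" "m' \<in> smooth Q" "q \<in> coprimes Q" "q' \<in> coprimes Q" "m * q = m' * q'"
  shows "m = m' \<and> q = q'"
proof -
  have "q dvd m' * q'" "q' dvd m * q" using assms(5) by (metis dvd_triv_right)+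
  then have "q dvd q'" "q' dvd q"
    using coprime_smooth assms by (metis coprime_dvd_mult_right_iff)+
  then have "q = q'" by (rule dvd_antisym)
  with assms show ?thesis by (auto simp: coprimes_def)
qed

text \<open>Strong induction, moving one prime shared with \<open>Q\<close> at a time into the
  smooth part.\<close>

lemma smooth_coprime_exists:
  assumes "n > 0"
  obtains m q where "m \<in> smooth Q" "q \<in> coprimes Q" "n = m * q"
proof -
  have "n > 0 \<Longrightarrow> \<exists>m\<in>smooth Q. \<exists>q\<in>coprimes Q. n = m * q"
  proof (induction n rule: less_induct)
    case (less n)
    show ?case
    proof (cases "coprime n Q")
      case True
      then have "1 \<in> smooth Q" "n \<in> coprimes Q" using less by (auto simp: smooth_def coprimes_def)
      then show ?thesis by force
    next
      case False
      then obtain p where p: "prime p" "p dvd n" "p dvd Q"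
        by (metis coprime_iff_gcd_eq_1 gcd_nat.bounded_iff prime_factor_nat)
      then obtain k where k: "n = p * k" by blast
      have "k < n" "k > 0" using k p less.prems prime_gt_1_nat[of p] by auto
      then obtain m q where "m \<in> smooth Q" "q \<in> coprimes Q" "k = m * q"
        using less.IH by blast
      moreover have "p \<in> smooth Q" using p dvd_smooth prime_gt_0_nat by blast
      ultimately show ?thesis using k smooth_mult by (metis mult.assoc)
    qed
  qed
  then show ?thesis using that assms by blast
qed

section \<open>The density of the integers coprime to Q\<close>

text \<open>Coprimality to \<open>Q\<close> has period \<open>Q\<close>, so the elements beyond the
  first period are a translate of those up to \<open>n\<close>.\<close>

lemma count_coprimes_add:
  assumes "Q > 0"
  shows "count_upto (coprimes Q) (n + Q) = count_upto (coprimes Q) n + count_upto (coprimes Q) Q"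
proof -
  have shift: "coprime (k + Q) Q \<longleftrightarrow> coprime k Q" for k
    by (metis coprime_iff_gcd_eq_1 gcd_add1)
  have "coprimes Q \<inter> {0<..n+Q} = (coprimes Q \<inter> {0<..Q}) \<union> (\<lambda>k. k + Q) ` (coprimes Q \<inter> {0<..n})"
  proof (intro equalityI subsetI)
    fix x assume x: "x \<in> coprimes Q \<inter> {0<..n+Q}"
    show "x \<in> (coprimes Q \<inter> {0<..Q}) \<union> (\<lambda>k. k + Q) ` (coprimes Q \<inter> {0<..n})"
    proof (cases "x \<le> Q")
      case False
      then have "x = (x - Q) + Q" by simp
      moreover have "coprime (x - Q) Q"
        using x shift[of "x - Q"] False by (auto simp: coprimes_def)
      ultimately show ?thesis using x False
        by (intro UnI2 image_eqI[of _ _ "x - Q"]) (auto simp: coprimes_def)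
    qed (use x in auto)
  qed (auto simp: coprimes_def shift)
  moreover have "(coprimes Q \<inter> {0<..Q}) \<inter> (\<lambda>k. k + Q) ` (coprimes Q \<inter> {0<..n}) = {}" by auto
  ultimately have "count_upto (coprimes Q) (n + Q) =
      card (coprimes Q \<inter> {0<..Q}) + card ((\<lambda>k. k + Q) ` (coprimes Q \<inter> {0<..n}))"
    unfolding count_upto_def by (metis card_Un_disjoint finite_Int finite_greaterThanAtMost finite_imageI)
  then show ?thesis by (simp add: card_image count_upto_def)
qed

text \<open>For positive \<open>Q\<close> this is Euler's totient of \<open>Q\<close> divided by
  \<open>Q\<close>, the proportion within one period.\<close>

definition coprime_dens :: "nat \<Rightarrow> real" where
  "coprime_dens Q = real (count_upto (coprimes Q) Q) / real Q"

lemma coprime_dens_bounds: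
  assumes "Q > 0"
  shows "0 < coprime_dens Q" "coprime_dens Q \<le> 1"
proof -
  have "1 \<in> coprimes Q \<inter> {0<..Q}" using assms by (auto simp: coprimes_def)
  then have "count_upto (coprimes Q) Q > 0" unfolding count_upto_def by (subst card_gt_0_iff) auto
  then show "0 < coprime_dens Q" using assms by (simp add: coprime_dens_def)
  show "coprime_dens Q \<le> 1" using count_upto_le[of "coprimes Q" Q] assms by (simp add: coprime_dens_def)
qed

text \<open>Removing a full period leaves the error unchanged, which reduces to
  \<open>n < Q\<close>, where both terms lie between 0 and \<open>Q\<close>.\<close>

lemma count_coprimes_error:
  assumes "Q > 0"
  shows "\<bar>real (count_upto (coprimes Q) n) - coprime_dens Q * real n\<bar> \<le> real Q"
proof (induction n rule: less_induct)
  case (less n)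
  show ?case
  proof (cases "n < Q")
    case True
    have "coprime_dens Q * real n \<le> 1 * real n" "0 \<le> coprime_dens Q * real n"
      using coprime_dens_bounds[OF assms] by (intro mult_right_mono mult_nonneg_nonneg; simp)+
    moreover have "real (count_upto (coprimes Q) n) \<le> real n" using count_upto_le by simp
    ultimately show ?thesis using True by simp
  next
    case False
    then have n: "n = (n - Q) + Q" by simp
    have "coprime_dens Q * real Q = real (count_upto (coprimes Q) Q)"
      using assms by (simp add: coprime_dens_def)
    then have "real (count_upto (coprimes Q) n) - coprime_dens Q * real n
      = real (count_upto (coprimes Q) (n - Q)) - coprime_dens Q * real (n - Q)"
      by (subst (1 2) n, subst count_coprimes_add[OF assms])
        (simp add: algebra_simps)
    then show ?thesis using less[of "n - Q"] False assms by simp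
  qed
qed

lemma count_coprimes_div_tendsto:
  assumes "Q > 0" "m > 0"
  shows "(\<lambda>n. real (count_upto (coprimes Q) (n div m)) / real n) \<longlonglongrightarrow> coprime_dens Q / real m"
proof -
  have "norm (real (count_upto (coprimes Q) (n div m)) / real n - coprime_dens Q / real m)
      \<le> (real Q + 1) * (1 / real n)" if "n > 0" for n
  proof -
    \<comment> \<open>Rounding \<open>n / m\<close> down costs at most 1, and
      \<open>coprime_dens Q\<close> is at most 1; this is the 1 in the error
      \<open>real Q + 1\<close>.\<close>
    have "real n / real m - real (n div m) \<le> 1" "0 \<le> real n / real m - real (n div m)"
      using floor_divide_of_nat_eq[of n m, where ?'a = real] by linarith+
    then have "coprime_dens Q * (real n / real m - real (n div m)) \<le> 1 * 1"
         "0 \<le> coprime_dens Q * (real n / real m - real (n div m))"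
      using coprime_dens_bounds[OF assms(1)] by (intro mult_mono mult_nonneg_nonneg; simp)+
    then have *: "\<bar>real (count_upto (coprimes Q) (n div m)) - coprime_dens Q * (real n / real m)\<bar> \<le> real Q + 1"
      using count_coprimes_error[OF assms(1), of "n div m"] by (simp add: algebra_simps)
    have "real (count_upto (coprimes Q) (n div m)) / real n - coprime_dens Q / real m
       = (real (count_upto (coprimes Q) (n div m)) - coprime_dens Q * (real n / real m)) / real n"
      using that by (simp add: diff_divide_distrib)
    then show ?thesis using * that by (simp add: abs_divide divide_right_mono)
  qed
  then have "(\<lambda>n. real (count_upto (coprimes Q) (n div m)) / real n - coprime_dens Q / real m) \<longlonglongrightarrow> 0"
    by (intro Lim_null_comparison[OF _ tendsto_mult_right_zero[OF lim_1_over_n, where c = "real Q + 1"]])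
      (auto simp: eventually_sequentially intro!: exI[of _ 1])
  then show ?thesis by (rule LIM_zero_cancel)
qed

section \<open>Product sets and weights of smooth numbers\<close>

definition times_coprimes :: "nat \<Rightarrow> nat set \<Rightarrow> nat set" where
  "times_coprimes Q T = (\<lambda>(m, q). m * q) ` (T \<times> coprimes Q)"

text \<open>Unique factorisation lets pairs be counted instead of products, and
  \<open>m * q \<le> n\<close> amounts to \<open>q \<le> n div m\<close>. Restricting to
  \<open>m \<le> n\<close> keeps the sum finite for infinite \<open>T\<close>.\<close>

lemma count_times_coprimes:
  assumes "T \<subseteq> smooth Q"
  shows "count_upto (times_coprimes Q T) n = (\<Sum>m\<in>T \<inter> {0<..n}. count_upto (coprimes Q) (n div m))"
proof -
  have inj: "inj_on (\<lambda>(m, q). m * q) (T \<times> coprimes Q)"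
    using assms by (auto simp: inj_on_def dest: smooth_coprime_unique subsetD)
  have pos: "m > 0" if "m \<in> T" for m using assms that by (auto simp: smooth_def)
  have "times_coprimes Q T \<inter> {0<..n}
      = (\<lambda>(m, q). m * q) ` (SIGMA m:T \<inter> {0<..n}. coprimes Q \<inter> {0<..n div m})" (is "?l = ?r")
  proof (intro equalityI subsetI)
    fix x assume "x \<in> ?l"
    then obtain m q where mq: "m \<in> T" "q \<in> coprimes Q" "x = m * q" "m * q \<le> n"
      by (auto simp: times_coprimes_def)
    have "m > 0" "q > 0" using mq pos by (auto simp: coprimes_def)
    then have "m \<le> n" "q \<le> n div m"
      using mq(4) by (auto simp: less_eq_div_iff_mult_less_eq ac_simps intro: order_trans[of m "m * q" n])
    then show "x \<in> ?r" using mq \<open>m > 0\<close> \<open>q > 0\<close> by auto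
  next
    fix x assume "x \<in> ?r"
    then show "x \<in> ?l"
      by (auto simp: times_coprimes_def less_eq_div_iff_mult_less_eq ac_simps)
  qed
  moreover have "inj_on (\<lambda>(m, q). m * q) (SIGMA m:T \<inter> {0<..n}. coprimes Q \<inter> {0<..n div m})"
    by (rule inj_on_subset[OF inj]) auto
  ultimately show ?thesis
    by (simp add: count_upto_def card_image card_SigmaI)
qed

text \<open>Among the integers up to \<open>n\<close> those with smooth part in \<open>F\<close> have limiting proportion
  \<open>coprime_dens Q * (\<Sum>m\<in>F. 1 / m)\<close>, which is at most 1; this replaces the Euler product.\<close>

lemma sum_smooth_le:
  assumes "Q > 0" "finite F" "F \<subseteq> smooth Q"
  shows "(\<Sum>m\<in>F. 1 / real m) \<le> 1 / coprime_dens Q"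
proof -
  have pos: "m > 0" if "m \<in> F" for m using assms that by (auto simp: smooth_def)
  have "(\<lambda>n. \<Sum>m\<in>F. real (count_upto (coprimes Q) (n div m)) / real n)
     \<longlonglongrightarrow> (\<Sum>m\<in>F. coprime_dens Q / real m)"
    using pos assms(1) by (intro tendsto_sum count_coprimes_div_tendsto) auto
  moreover have "(\<Sum>m\<in>F. real (count_upto (coprimes Q) (n div m)) / real n) \<le> 1" for n
  proof -
    have "(\<Sum>m\<in>F. real (count_upto (coprimes Q) (n div m)))
       = (\<Sum>m\<in>F \<inter> {0<..n}. real (count_upto (coprimes Q) (n div m)))"
      using assms(2) pos by (intro sum.mono_neutral_right) (auto simp: count_upto_def)
    also have "\<dots> = real (count_upto (times_coprimes Q F) n)"
      using count_times_coprimes[OF assms(3), of n] by simp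
    also have "\<dots> \<le> real n" using count_upto_le by simp
    finally show ?thesis
      by (cases "n = 0") (auto simp: sum_divide_distrib[symmetric] divide_le_eq_1)
  qed
  ultimately have "(\<Sum>m\<in>F. coprime_dens Q / real m) \<le> 1"
    by (intro LIMSEQ_le_const2) auto
  then have "coprime_dens Q * (\<Sum>m\<in>F. 1 / real m) \<le> 1"
    by (simp add: sum_distrib_left)
  then show ?thesis using coprime_dens_bounds[OF assms(1)] by (simp add: field_simps)
qed

text \<open>Extension by 0 turns sums over infinite sets of smooth numbers into series over all
  naturals.\<close>

definition weight :: "nat \<Rightarrow> nat \<Rightarrow> real" where
  "weight Q m = (if m \<in> smooth Q then 1 / real m else 0)"

lemma weight_nonneg: "0 \<le> weight Q m"
  by (simp add: weight_def)

lemma summable_weight: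
  assumes "Q > 0"
  shows "summable (weight Q)"
proof (rule summableI_nonneg_bounded)
  fix n
  have "(\<Sum>m<n. weight Q m) = (\<Sum>m\<in>{..<n} \<inter> smooth Q. 1 / real m)"
    by (simp add: weight_def sum.inter_restrict)
  also have "\<dots> \<le> 1 / coprime_dens Q" using assms by (intro sum_smooth_le) auto
  finally show "(\<Sum>m<n. weight Q m) \<le> 1 / coprime_dens Q" .
qed (rule weight_nonneg)

definition total_weight :: "nat \<Rightarrow> nat set \<Rightarrow> real" where
  "total_weight Q T = (\<Sum>m. of_bool (m \<in> T) * weight Q m)"

text \<open>Dominated convergence for series: the proportion contributed by each \<open>m\<close>
  converges, and it is bounded by the summable \<open>weight Q m\<close> uniformly in
  \<open>n\<close>.\<close>

lemma density_times_coprimes: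
  assumes "Q > 0" "T \<subseteq> smooth Q"
  shows "has_density (times_coprimes Q T) (ereal (coprime_dens Q * total_weight Q T))"
proof (rule has_densityI)
  let ?C = "count_upto (coprimes Q)"
  let ?a = "\<lambda>m n. of_bool (m \<in> T) * (real (?C (n div m)) / real n)"
  have pos: "m > 0" if "m \<in> T" for m using assms that by (auto simp: smooth_def)
  have "((\<lambda>n. suminf (\<lambda>m. ?a m n)) \<longlonglongrightarrow> (\<Sum>m. of_bool (m \<in> T) * (coprime_dens Q * weight Q m)))"
  proof (rule tannerys_theorem[where M = "weight Q", THEN conjunct2, THEN conjunct2])
    show "(\<lambda>n. ?a m n) \<longlonglongrightarrow> of_bool (m \<in> T) * (coprime_dens Q * weight Q m)" for m
    proof (cases "m \<in> T")
      case True
      then show ?thesis using count_coprimes_div_tendsto[OF assms(1) pos[OF True]] assms(2)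
        by (auto simp: weight_def)
    qed auto
    have "norm (?a m n) \<le> weight Q m" for m n
    proof (cases "m \<in> T \<and> n > 0")
      case True
      have "real (?C (n div m)) \<le> real (n div m)" using count_upto_le by simp
      also have "\<dots> \<le> real n / real m" by (rule of_nat_div_le_of_nat)
      finally have "real (?C (n div m)) / real n \<le> 1 / real m"
        using True pos by (simp add: field_simps)
      then show ?thesis using True assms(2) by (auto simp: weight_def)
    qed (auto simp: weight_nonneg)
    then show "\<forall>\<^sub>F (m, n) in sequentially \<times>\<^sub>F sequentially. norm (?a m n) \<le> weight Q m"
      by (intro always_eventually) auto
  qed (use summable_weight[OF assms(1)] in auto)
  moreover have "suminf (\<lambda>m. ?a m n) = real (count_upto (times_coprimes Q T) n) / real n" for n
  proof -
    \<comment> \<open>The series terminates: \<open>n div m = 0\<close> for \<open>m > n\<close>,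
      and 0 is not in \<open>T\<close>.\<close>
    have "suminf (\<lambda>m. ?a m n) = (\<Sum>m\<in>{0<..n}. ?a m n)"
      by (rule suminf_finite) (use pos in \<open>auto simp: count_upto_def not_le\<close>)
    also have "\<dots> = (\<Sum>m\<in>T \<inter> {0<..n}. real (?C (n div m)) / real n)"
      by (intro sum.mono_neutral_cong_right) auto
    finally show ?thesis
      using count_times_coprimes[OF assms(2), of n] by (simp add: sum_divide_distrib)
  qed
  moreover have "(\<Sum>m. of_bool (m \<in> T) * (coprime_dens Q * weight Q m)) = coprime_dens Q * total_weight Q T"
  proof -
    have "summable (\<lambda>m. of_bool (m \<in> T) * weight Q m)"
      by (rule summable_comparison_test'[OF summable_weight[OF assms(1)]]) (auto simp: weight_nonneg)
    then show ?thesis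
      unfolding total_weight_def by (subst suminf_mult[symmetric]) (auto simp: ac_simps)
  qed
  ultimately show "(\<lambda>n. real (count_upto (times_coprimes Q T) n) / real n)
      \<longlonglongrightarrow> coprime_dens Q * total_weight Q T" by simp
qed

section \<open>Extremal sets\<close>

text \<open>A continuous function on a nonempty compact set attains its maximum. Sets are encoded as
  points of the product of countably many copies of the discrete space \<open>bool\<close>.\<close>

lemma ex_max_weight:
  fixes w :: "nat \<Rightarrow> real"
  assumes "summable w" "\<And>m. 0 \<le> w m"
  obtains T where "\<And>x y. x \<in> T \<Longrightarrow> y \<in> T \<Longrightarrow> \<not> R x y"
    "\<And>U. (\<And>x y. x \<in> U \<Longrightarrow> y \<in> U \<Longrightarrow> \<not> R x y) \<Longrightarrow>
       (\<Sum>m. of_bool (m \<in> U) * w m) \<le> (\<Sum>m. of_bool (m \<in> T) * w m)"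
proof -
  define I where "I = {f :: nat \<Rightarrow> bool. \<forall>x y. f x \<and> f y \<longrightarrow> \<not> R x y}"
  define F where "F f = (\<Sum>m. of_bool (f m) * w m)" for f :: "nat \<Rightarrow> bool"
  \<comment> \<open>Tychonoff's theorem, with each factor finite and hence compact.\<close>
  have "compact_space (product_topology (\<lambda>_::nat. euclidean :: bool topology) UNIV)"
    unfolding compact_space_product_topology
    by (simp add: compact_space_def compactin_euclidean_iff finite_imp_compact)
  then have comp: "compact (UNIV :: (nat \<Rightarrow> bool) set)"
    by (simp add: euclidean_product_topology compact_space_def compactin_euclidean_iff)
  have coord: "continuous_on A (\<lambda>f :: nat \<Rightarrow> bool. f m)" for m A
    by (rule continuous_on_subset[OF continuous_on_product_coordinates]) simp
  have clopen: "open {f :: nat \<Rightarrow> bool. f m}" "closed {f :: nat \<Rightarrow> bool. f m}" for m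
  proof -
    have "open ((\<lambda>f :: nat \<Rightarrow> bool. f m) -` {True})" by (rule open_vimage[OF open_discrete coord])
    then show "open {f :: nat \<Rightarrow> bool. f m}" by (simp add: vimage_def)
    have "closed ((\<lambda>f :: nat \<Rightarrow> bool. f m) -` {True})" by (rule closed_vimage[OF closed_singleton coord])
    then show "closed {f :: nat \<Rightarrow> bool. f m}" by (simp add: vimage_def)
  qed
  \<comment> \<open>Each forbidden pair constrains only two coordinates, so \<open>I\<close> is an
    intersection of closed sets.\<close>
  have "closed I" unfolding I_def
    by (intro closed_Collect_all closed_Collect_imp open_Collect_conj clopen) auto
  then have "compact I" using compact_Int_closed[OF comp] by simp
  moreover have "(\<lambda>_. False) \<in> I" by (auto simp: I_def)
  moreover have "continuous_on I F"
  proof (rule uniform_limit_theorem)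
    \<comment> \<open>The terms are dominated by \<open>w m\<close> independently of
      \<open>f\<close>, so the M-test gives uniform convergence and the continuous partial sums have
      a continuous limit.\<close>
    show "uniform_limit I (\<lambda>n f. \<Sum>m<n. of_bool (f m) * w m) F sequentially"
      unfolding F_def by (rule Weierstrass_m_test[OF _ assms(1)]) (auto simp: assms(2))
    have "continuous_on UNIV (of_bool :: bool \<Rightarrow> real)" by (simp add: continuous_on_open_vimage open_discrete)
    then have "continuous_on I (\<lambda>f. of_bool (f m) :: real)" for m
      by (rule continuous_on_compose2[OF _ coord]) auto
    then show "\<forall>\<^sub>F n in sequentially. continuous_on I (\<lambda>f. \<Sum>m<n. of_bool (f m) * w m)"
      by (intro always_eventually allI continuous_intros) auto
  qed auto
  ultimately obtain g where g: "g \<in> I" "\<And>f. f \<in> I \<Longrightarrow> F f \<le> F g"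
    using continuous_attains_sup[of I F] by blast
  show ?thesis
  proof (rule that[of "Collect g"])
    show "\<not> R x y" if "x \<in> Collect g" "y \<in> Collect g" for x y
      using g(1) that by (auto simp: I_def)
    show "(\<Sum>m. of_bool (m \<in> U) * w m) \<le> (\<Sum>m. of_bool (m \<in> Collect g) * w m)"
      if "\<And>x y. x \<in> U \<Longrightarrow> y \<in> U \<Longrightarrow> \<not> R x y" for U
      using g(2)[of "\<lambda>m. m \<in> U"] that by (auto simp: I_def F_def)
  qed
qed

lemma ex_max_quotient_free:
  assumes "Q > 0"
  obtains T where "T \<subseteq> smooth Q" "quotient_free A T"
    "\<And>U. U \<subseteq> smooth Q \<Longrightarrow> quotient_free A U \<Longrightarrow> total_weight Q U \<le> total_weight Q T"
proof -
  \<comment> \<open>The first disjunct, applied with \<open>y = x\<close>, encodes the restriction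
    to smooth numbers in the relation itself.\<close>
  let ?R = "\<lambda>x y. x \<notin> smooth Q \<or> (of_nat x / of_nat y :: rat) \<in> A"
  show ?thesis
  proof (rule ex_max_weight[OF summable_weight[OF assms] weight_nonneg, of ?R],
      fold total_weight_def, rule that)
    fix T
    assume T: "\<And>x y. x \<in> T \<Longrightarrow> y \<in> T \<Longrightarrow> \<not> ?R x y"
      "\<And>U. (\<And>x y. x \<in> U \<Longrightarrow> y \<in> U \<Longrightarrow> \<not> ?R x y) \<Longrightarrow> total_weight Q U \<le> total_weight Q T"
    show sub: "T \<subseteq> smooth Q" using T(1) by blast
    have "0 < x" if "x \<in> T" for x using sub that by (auto simp: smooth_def)
    moreover have "of_nat x / of_nat y \<notin> A" if "x \<in> T" "y \<in> T" for x y
      using T(1)[OF that] by simp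
    ultimately show "quotient_free A T" by (simp add: quotient_free_def)
    show "total_weight Q U \<le> total_weight Q T" if U: "U \<subseteq> smooth Q" "quotient_free A U" for U
    proof (rule T(2))
      fix x y assume "x \<in> U" "y \<in> U"
      then have "x \<in> smooth Q" "of_nat x / of_nat y \<notin> A"
        using U by (auto simp: quotient_free_def)
      then show "\<not> ?R x y" by simp
    qed
  qed
qed

lemma sum_eq_total_weight:
  assumes "Q > 0" "finite F" "F \<subseteq> smooth Q"
  shows "(\<Sum>m\<in>F. 1 / real m) = total_weight Q F"
proof -
  have "total_weight Q F = (\<Sum>m\<in>F. of_bool (m \<in> F) * weight Q m)"
    unfolding total_weight_def using assms(2) by (intro suminf_finite) auto
  also have "\<dots> = (\<Sum>m\<in>F. 1 / real m)"
    using assms(3) by (intro sum.cong) (auto simp: weight_def)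
  finally show ?thesis by simp
qed

section \<open>The upper bound and its attainment\<close>

text \<open>The slice at a coprime part \<open>q\<close> contributes at most \<open>W / q\<close>,
  and partial summation bounds the sum of \<open>1 / q\<close> by
  \<open>coprime_dens Q * harm n + Q\<close>.\<close>

lemma upper_log_density_quotient_free:
  assumes "Q > 0" "quotient_free A S"
    and max: "\<And>U. U \<subseteq> smooth Q \<Longrightarrow> quotient_free A U \<Longrightarrow> total_weight Q U \<le> W"
  shows "upper_log_density S \<le> ereal (coprime_dens Q * W)"
proof -
  have W0: "W \<ge> 0" using max[of "{}"] by (simp add: quotient_free_def total_weight_def)
  have "recip_sum S n \<le> (coprime_dens Q * W) * harm n + real Q * W" for n
  proof -
    \<comment> \<open>Truncating the slices at \<open>n\<close> makes them finite, so their
      reciprocal sums are finite sums.\<close>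
    let ?U = "\<lambda>q. {m \<in> smooth Q. m * q \<in> S \<and> m * q \<le> n}"
    let ?K = "coprimes Q \<inter> {0<..n}"
    have fin: "finite (?U q)" if "q \<in> ?K" for q
    proof (rule finite_subset)
      show "?U q \<subseteq> {..n}"
      proof
        fix m assume "m \<in> ?U q"
        then have "m * q \<le> n" by simp
        moreover have "m \<le> m * q" using that by (simp add: coprimes_def)
        ultimately show "m \<in> {..n}" by (simp only: atMost_iff)
      qed
    qed simp
    have finS: "finite (SIGMA q:?K. ?U q)"
      by (rule finite_SigmaI[OF _ fin]) auto
    have "S \<inter> {0<..n} \<subseteq> (\<lambda>(q, m). m * q) ` (SIGMA q:?K. ?U q)"
    proof
      fix x assume x: "x \<in> S \<inter> {0<..n}"
      then obtain m q where mq: "m \<in> smooth Q" "q \<in> coprimes Q" "x = m * q"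
        using smooth_coprime_exists[of x Q] by auto
      have "m > 0" "q > 0" using mq by (auto simp: coprimes_def smooth_def)
      then have "q \<le> n" using x mq by (auto intro: order_trans[of q "m * q" n])
      then show "x \<in> (\<lambda>(q, m). m * q) ` (SIGMA q:?K. ?U q)"
        using x mq \<open>q > 0\<close> by (auto intro!: image_eqI[of _ _ "(q, m)"])
    qed
    then have "recip_sum S n \<le> (\<Sum>k\<in>(\<lambda>(q, m). m * q) ` (SIGMA q:?K. ?U q). 1 / real k)"
      unfolding recip_sum_def by (intro sum_mono2 finite_imageI[OF finS]) auto
    also have "\<dots> \<le> (\<Sum>(q, m)\<in>(SIGMA q:?K. ?U q). 1 / real (m * q))"
      using sum_image_le[OF finS, of "\<lambda>k. 1 / real k" "\<lambda>(q, m). m * q"]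
      by (auto simp: case_prod_unfold comp_def)
    also have "\<dots> = (\<Sum>q\<in>?K. \<Sum>m\<in>?U q. 1 / real (m * q))"
      by (rule sum.Sigma[symmetric]) (use fin in auto)
    also have "\<dots> = (\<Sum>q\<in>?K. (\<Sum>m\<in>?U q. 1 / real m) * (1 / real q))"
      by (simp add: sum_distrib_right sum_divide_distrib)
    also have "\<dots> \<le> (\<Sum>q\<in>?K. W * (1 / real q))"
    proof (intro sum_mono mult_right_mono)
      fix q assume q: "q \<in> ?K"
      \<comment> \<open>The common factor \<open>q\<close> cancels in quotients of elements
        \<open>m * q\<close> of \<open>S\<close>.\<close>
      have "quotient_free A (?U q)"
        using assms(2) q unfolding quotient_free_def
        by (auto simp: smooth_def) (metis (no_types, lifting) nonzero_mult_divide_mult_cancel_right of_nat_0_eq_iff of_nat_mult not_gr_zero)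
      then show "(\<Sum>m\<in>?U q. 1 / real m) \<le> W"
        using sum_eq_total_weight[OF assms(1) fin[OF q]] max[of "?U q"] by auto
    qed auto
    also have "\<dots> = W * recip_sum (coprimes Q) n"
      by (simp add: recip_sum_def sum_distrib_left)
    also have "\<dots> \<le> W * (coprime_dens Q * harm n + real Q)"
    proof (intro mult_left_mono recip_sum_upper W0)
      show "real (count_upto (coprimes Q) k) \<le> coprime_dens Q * real k + real Q" for k
        using count_coprimes_error[OF assms(1), of k] by linarith
    qed
    finally show ?thesis by (simp add: algebra_simps)
  qed
  then show ?thesis
    using W0 coprime_dens_bounds[OF assms(1)] by (intro upper_log_density_le) auto
qed

text \<open>If \<open>(m * q) / (m' * q') = u / v\<close> lies in \<open>A\<close>, then
  \<open>(m * v) * q = (u * m') * q'\<close> has smooth first factors, so uniqueness gives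
  \<open>m / m' = u / v\<close>, contradicting the choice of \<open>T\<close>.\<close>

lemma quotient_free_times_coprimes:
  assumes T: "T \<subseteq> smooth Q" "quotient_free A T"
    and A: "\<And>a. a \<in> A \<Longrightarrow> \<exists>u\<in>smooth Q. \<exists>v\<in>smooth Q. a = of_nat u / of_nat v"
  shows "quotient_free A (times_coprimes Q T)"
  unfolding quotient_free_def
proof (intro conjI ballI)
  fix x assume "x \<in> times_coprimes Q T"
  then show "0 < x" using T(1) by (auto simp: times_coprimes_def coprimes_def smooth_def)
next
  fix x y assume "x \<in> times_coprimes Q T" "y \<in> times_coprimes Q T"
  then obtain m q m' q' where
    x: "m \<in> T" "q \<in> coprimes Q" "x = m * q" and y: "m' \<in> T" "q' \<in> coprimes Q" "y = m' * q'"
    by (auto simp: times_coprimes_def)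
  have pos: "m > 0" "m' > 0" "q > 0" "q' > 0"
    using x y T(1) by (auto simp: coprimes_def smooth_def)
  show "(of_nat x / of_nat y :: rat) \<notin> A"
  proof
    assume a: "(of_nat x / of_nat y :: rat) \<in> A"
    then obtain u v where uv: "u \<in> smooth Q" "v \<in> smooth Q" "(of_nat x / of_nat y :: rat) = of_nat u / of_nat v"
      using A by blast
    have uv0: "u > 0" "v > 0" using uv by (auto simp: smooth_def)
    have "(of_nat (x * v) :: rat) = of_nat (u * y)"
      using uv(3) uv0 pos y by (simp add: frac_eq_eq)
    then have "(m * v) * q = (u * m') * q'"
      using x y by (simp only: of_nat_eq_iff) (simp add: ac_simps)
    moreover have "m * v \<in> smooth Q" "u * m' \<in> smooth Q"
      using uv x y T(1) by (auto intro: smooth_mult)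
    ultimately have "m * v = u * m'"
      using smooth_coprime_unique x(2) y(2) by blast
    then have "(of_nat m * of_nat v :: rat) = of_nat u * of_nat m'" by (metis of_nat_mult)
    then have "(of_nat m / of_nat m' :: rat) = of_nat u / of_nat v"
      using pos uv0 by (simp add: frac_eq_eq)
    then have "(of_nat m / of_nat m' :: rat) \<in> A" using a uv(3) by simp
    then show False using T(2) x(1) y(1) by (auto simp: quotient_free_def)
  qed
qed

section \<open>Choice of the modulus and conclusion\<close>

lemma pos_rat_as_nat_quotient:
  fixes a :: rat
  assumes "0 < a"
  shows "\<exists>u v. 0 < u \<and> 0 < v \<and> a = of_nat u / of_nat v"
proof -
  obtain n d where nd: "quotient_of a = (n, d)" by fastforce
  then have a: "a = of_int n / of_int d" "d > 0"
    by (auto simp: quotient_of_div quotient_of_denom_pos)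
  then have "n > 0" using assms by (simp add: zero_less_divide_iff)
  then show ?thesis using a by (intro exI[of _ "nat n"] exI[of _ "nat d"]) auto
qed

lemma ex_smooth_modulus:
  fixes A :: "rat set"
  assumes "finite A" "\<forall>a\<in>A. 0 < a"
  obtains Q where "Q > 0" "\<And>a. a \<in> A \<Longrightarrow> \<exists>u\<in>smooth Q. \<exists>v\<in>smooth Q. a = of_nat u / of_nat v"
proof -
  have "\<forall>a\<in>A. \<exists>u v. 0 < u \<and> 0 < v \<and> a = of_nat u / of_nat v"
    using pos_rat_as_nat_quotient assms(2) by blast
  then obtain u v where uv: "\<And>a. a \<in> A \<Longrightarrow> 0 < u a \<and> 0 < v a \<and> a = of_nat (u a) / of_nat (v a)"
    by metis
  \<comment> \<open>Every chosen numerator and denominator divides this product, so each is smooth;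
    for empty \<open>A\<close> it is 1.\<close>
  define Q where "Q = (\<Prod>a\<in>A. u a * v a)"
  show ?thesis
  proof (rule that[of Q])
    show "Q > 0" unfolding Q_def using uv by (intro prod_pos) auto
    fix a assume a: "a \<in> A"
    then have "u a * v a dvd Q" unfolding Q_def using assms(1) by (intro dvd_prodI) auto
    then have "u a dvd Q" "v a dvd Q" by (auto dest: dvd_mult_left dvd_mult_right)
    then have "u a \<in> smooth Q" "v a \<in> smooth Q" using uv[OF a] dvd_smooth by blast+
    moreover have "a = of_nat (u a) / of_nat (v a)" using uv[OF a] by blast
    ultimately show "\<exists>u\<in>smooth Q. \<exists>v\<in>smooth Q. a = of_nat u / of_nat v" by blast
  qed
qed

theorem theorem3:
  fixes A :: "rat set"
  assumes "finite A" and "\<forall>a\<in>A. 0 < a"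
  shows "rho A = rho_lower A \<and> rho_lower A = rho_log A \<and>
         rho_log A = rho_log_lower A \<and> rho_log_lower A = rho_log_upper A \<and>
         (\<exists>S. quotient_free A S \<and> has_density S (rho A))"
proof -
  obtain Q where Q: "Q > 0"
    "\<And>a. a \<in> A \<Longrightarrow> \<exists>u\<in>smooth Q. \<exists>v\<in>smooth Q. a = of_nat u / of_nat v"
    using ex_smooth_modulus assms by metis
  obtain T where T: "T \<subseteq> smooth Q" "quotient_free A T"
    "\<And>U. U \<subseteq> smooth Q \<Longrightarrow> quotient_free A U \<Longrightarrow> total_weight Q U \<le> total_weight Q T"
    using ex_max_quotient_free[OF Q(1)] by metis
  define c where "c = ereal (coprime_dens Q * total_weight Q T)"
  define S0 where "S0 = times_coprimes Q T"
  have S0: "quotient_free A S0" "has_density S0 c"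
    unfolding S0_def c_def
    using quotient_free_times_coprimes[OF T(1,2) Q(2)] density_times_coprimes[OF Q(1) T(1)] by auto
  have ul: "upper_log_density S \<le> c" if "quotient_free A S" for S
    unfolding c_def using upper_log_density_quotient_free[OF Q(1) that T(3)] .
  have ll: "lower_log_density S \<le> c" if "quotient_free A S" for S
    using ul[OF that] lower_log_le_upper_log order_trans by blast
  have ld: "lower_density S \<le> c" if "quotient_free A S" for S
    using ll[OF that] lower_density_le_lower_log order_trans by blast
  have S0ld: "lower_density S0 = c" using S0(2) by (simp add: has_density_def)
  \<comment> \<open>The lower density \<open>c\<close> of \<open>S0\<close> bounds its logarithmic
    densities from below and \<open>ul\<close> bounds them from above, so all of them equal
    \<open>c\<close>.\<close>
  have S0ll: "lower_log_density S0 = c"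
    using lower_density_le_lower_log[of S0] ll[OF S0(1)] S0ld by simp
  have S0ul: "upper_log_density S0 = c"
    using lower_log_le_upper_log[of S0] ul[OF S0(1)] S0ll by simp
  \<comment> \<open>In each of the five suprema \<open>c\<close> is an upper bound attained at
    \<open>S0\<close>.\<close>
  have "rho A = c" unfolding rho_def
    using S0 ld by (intro Sup_eqI) (auto simp: has_density_def)
  moreover have "rho_lower A = c" unfolding rho_lower_def
    using S0 S0ld ld by (intro SUP_eqI) auto
  moreover have "rho_log A = c" unfolding rho_log_def
    using S0 S0ll S0ul ll by (intro Sup_eqI) (auto simp: has_log_density_def)
  moreover have "rho_log_lower A = c" unfolding rho_log_lower_def
    using S0 S0ll ll by (intro SUP_eqI) auto
  moreover have "rho_log_upper A = c" unfolding rho_log_upper_def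
    using S0 S0ul ul by (intro SUP_eqI) auto
  ultimately show ?thesis using S0 by metis
qed

end
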